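(* Let $n\ge 1$ and let $S,T\subseteq V(G_n)$ be nonempty and distinct. Then $S$ and $T$ are not directionally equivalent. Equivalently, there exists an oriented edge $(\lambda,\mu)$ of $G_n$ such that $\sigma_S(\lambda,\mu)\neq\sigma_T(\lambda,\mu)$.
   Context: Partition graph: for $n\ge 1$, the vertices of the simple graph $G_n$ are the partitions $\lambda=(\lambda_1\ge\dots\ge\lambda_k>0)$ of $n$. An elementary unit transfer on $\lambda=(\lambda_1,\dots,\lambda_k)$: choose distinct indices $i,j\in\{1,\dots,k\}$, replace $\lambda_i$ by $\lambda_i+1$ and $\lambda_j$ by $\lambda_j-1$, delete the latter if it becomes $0$, and reorder the parts into nonincreasing form; if the resulting partition $\mu$ satisfies $\mu\neq\lambda$, then $\mu$ is obtained from $\lambda$ by an elementary unit transfer. Two partitions $\lambda,\mu$ of $n$ are adjacent in $G_n$ if one of them is obtained from the other by a single elementary unit transfer. The graph $G_n$ is connected. For nonempty $S\subseteq V(G_n)$, $d_S(\lambda)=\min_{\sigma\in S}d_{G_n}(\lambda,\sigma)$, where $d_{G_n}$ is the graph distance. An oriented edge is an ordered pair $(\lambda,\mu)$ of adjacent vertices, and $\sigma_S(\lambda,\mu)=d_S(\mu)-d_S(\lambda)\in\{-1,0,+1\}$. Nonempty sets $S,T\subseteq V(G_n)$ are directionally equivalent if $\sigma_S(\lambda,\mu)=\sigma_T(\lambda,\mu)$ for every oriented edge $(\lambda,\mu)$ of $G_n$. *)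

theory Defs
  imports "Graph_Theory.Graph_Theory"
begin

definition partitions :: "nat \<Rightarrow> nat list set" where
  "partitions n = {l. sorted_wrt (\<ge>) l \<and> (\<forall>x\<in>set l. 0 < x) \<and> sum_list l = n}"

text \<open>
  Indices are 0-based. The parts of a partition are positive, so the subtraction is never
  truncated, and the only part the filter can remove is the decreased one.
\<close>

definition transfer_unit :: "nat list \<Rightarrow> nat \<Rightarrow> nat \<Rightarrow> nat list" where
  "transfer_unit l i j = rev (sort (filter (\<lambda>x. x \<noteq> 0) (l[i := l ! i + 1, j := l ! j - 1])))"

definition elementary_unit_transfer :: "nat list \<Rightarrow> nat list \<Rightarrow> bool" where
  "elementary_unit_transfer l m \<longleftrightarrow>
     (\<exists>i j. i < length l \<and> j < length l \<and> i \<noteq> j \<and> m = transfer_unit l i j) \<and> m \<noteq> l"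

text \<open>
  A simple graph is represented by a symmetric, loop-free digraph, so that its arcs are exactly
  the oriented edges.
\<close>

definition partition_graph :: "nat \<Rightarrow> nat list pair_pre_digraph" where
  "partition_graph n =
     \<lparr> pverts = partitions n,
       parcs = {(l, m). l \<in> partitions n \<and> m \<in> partitions n \<and>
                  (elementary_unit_transfer l m \<or> elementary_unit_transfer m l)} \<rparr>"

text \<open>The value is unspecified if no walk joins the two vertices; partition graphs are connected.\<close>

definition graph_dist :: "'a pair_pre_digraph \<Rightarrow> 'a \<Rightarrow> 'a \<Rightarrow> nat" where
  "graph_dist G u v = (LEAST k. \<exists>p. pre_digraph.awalk (with_proj G) u p v \<and> length p = k)"

definition set_dist :: "'a pair_pre_digraph \<Rightarrow> 'a set \<Rightarrow> 'a \<Rightarrow> nat" where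
  "set_dist G S u = Min (graph_dist G u ` S)"

definition edge_sign :: "'a pair_pre_digraph \<Rightarrow> 'a set \<Rightarrow> 'a \<Rightarrow> 'a \<Rightarrow> int" where
  "edge_sign G S u v = int (set_dist G S v) - int (set_dist G S u)"

definition directionally_equivalent :: "'a pair_pre_digraph \<Rightarrow> 'a set \<Rightarrow> 'a set \<Rightarrow> bool" where
  "directionally_equivalent G S T \<longleftrightarrow>
     (\<forall>(u, v)\<in>parcs G. edge_sign G S u v = edge_sign G T u v)"

text \<open>
  The minima above are attained, since the graph is finite and (for positive \<open>n\<close>) connected.
\<close>

lemma finite_partitions: "finite (partitions n)"
proof (rule finite_subset)
  have "length l \<le> sum_list l" if "\<forall>x\<in>set l. 0 < x" for l :: "nat list"
    using that by (induction l) auto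
  then show "partitions n \<subseteq> {l. set l \<subseteq> {..n} \<and> length l \<le> n}"
    by (auto simp: partitions_def dest: member_le_sum_list)
  show "finite {l. set l \<subseteq> {..n} \<and> length l \<le> n}"
    by (rule finite_lists_length_le) simp
qed

lemma pair_graph_partition_graph: "pair_graph (partition_graph n)"
proof
  show "finite (parcs (partition_graph n))"
    by (rule finite_subset[of _ "partitions n \<times> partitions n"])
      (auto simp: partition_graph_def finite_partitions)
qed (auto simp: partition_graph_def finite_partitions elementary_unit_transfer_def
      symmetric_def sym_def)

lemma sum_list_filter_pos: "sum_list (filter ((<) 0) l) = sum_list (l :: nat list)"
  by (induction l) auto

lemma transfer_unit_in_partitions:
  assumes l: "l \<in> partitions n" and ij: "i < length l" "j < length l" "i \<noteq> j"
  shows "transfer_unit l i j \<in> partitions n"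
proof -
  have j: "0 < l ! j" using l ij by (auto simp: partitions_def)
  have "sum_list (l[i := l ! i + 1]) = sum_list l + 1"
    using ij elem_le_sum_list[of i l] by (simp add: sum_list_update)
  moreover have "sum_list (l[i := l ! i + 1, j := l ! j - 1]) + 1 = sum_list (l[i := l ! i + 1])"
    using ij j elem_le_sum_list[of j "l[i := l ! i + 1]"] by (simp add: sum_list_update)
  moreover have "sum_list (rev (sort xs)) = sum_list xs" for xs :: "nat list"
    by (metis mset_rev mset_sort sum_mset_sum_list)
  ultimately show ?thesis using l
    by (auto simp: partitions_def transfer_unit_def sorted_wrt_rev sum_list_filter_pos)
qed

lemma single_part_reachable:
  assumes "l \<in> partitions n" "0 < n"
  shows "l \<rightarrow>\<^sup>*\<^bsub>with_proj (partition_graph n)\<^esub> [n]"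
  using assms(1)
proof (induction "n - hd l" arbitrary: l rule: less_induct)
  case less
  interpret pair_graph "partition_graph n" by (rule pair_graph_partition_graph)
  note l = less.prems
  obtain a xs where axs: "l = a # xs" using l \<open>0 < n\<close> by (cases l) (auto simp: partitions_def)
  show ?case
  proof (cases xs)
    case Nil
    then have "l = [n]" using l axs by (auto simp: partitions_def)
    moreover have "[n] \<in> pverts (partition_graph n)"
      using l \<open>l = [n]\<close> by (simp add: partition_graph_def)
    ultimately show ?thesis by (simp add: reachable_refl)
  next
    case (Cons b ys)
    define m where "m = transfer_unit l 0 1"
    have m: "m \<in> partitions n"
      unfolding m_def by (rule transfer_unit_in_partitions) (use l axs Cons in auto)
    have "a + 1 \<in> set m" using axs Cons by (auto simp: m_def transfer_unit_def set_insort_key)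
    moreover from this obtain c zs where czs: "m = c # zs" by (cases m) auto
    ultimately have ac: "a + 1 \<le> c" using m by (auto simp: partitions_def)
    have "c \<le> n" using m czs by (auto simp: partitions_def)
    then have "m \<rightarrow>\<^sup>*\<^bsub>with_proj (partition_graph n)\<^esub> [n]"
      using less.hyps[of m] m axs czs ac by simp
    moreover have "elementary_unit_transfer l m"
      unfolding elementary_unit_transfer_def
    proof
      show "\<exists>i j. i < length l \<and> j < length l \<and> i \<noteq> j \<and> m = transfer_unit l i j"
        by (rule exI[of _ 0], rule exI[of _ 1]) (use axs Cons m_def in auto)
      show "m \<noteq> l" using axs czs ac by auto
    qed
    then have "(l, m) \<in> parcs (partition_graph n)" using l m by (simp add: partition_graph_def)
    ultimately show ?thesis
      by (metis adj_reachable_trans with_proj_simps(3))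
  qed
qed

lemma connected_partition_graph:
  assumes "0 < n"
  shows "connected (with_proj (partition_graph n))"
proof -
  interpret pair_graph "partition_graph n" by (rule pair_graph_partition_graph)
  have 1: "[n] \<in> pverts (partition_graph n)"
    using assms by (simp add: partition_graph_def partitions_def)
  have "strongly_connected (mk_symmetric (with_proj (partition_graph n)))"
  proof
    show "verts (mk_symmetric (with_proj (partition_graph n))) \<noteq> {}"
      using 1 by (auto simp: mk_symmetric_def)
    fix u v
    assume "u \<in> verts (mk_symmetric (with_proj (partition_graph n)))"
      "v \<in> verts (mk_symmetric (with_proj (partition_graph n)))"
    then have "u \<rightarrow>\<^sup>*\<^bsub>with_proj (partition_graph n)\<^esub> [n]" "v \<rightarrow>\<^sup>*\<^bsub>with_proj (partition_graph n)\<^esub> [n]"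
      using single_part_reachable[OF _ assms] by (simp_all add: mk_symmetric_def partition_graph_def)
    then have "u \<rightarrow>\<^sup>*\<^bsub>with_proj (partition_graph n)\<^esub> v"
      by (meson reachable_trans symmetric_reachable sym_arcs)
    then show "u \<rightarrow>\<^sup>*\<^bsub>mk_symmetric (with_proj (partition_graph n))\<^esub> v"
      using reachable_mk_symmetric_eq[OF sym_arcs] by simp
  qed
  then show ?thesis by (simp add: connected_def)
qed

end

theory Submission
  imports Defs
begin

text \<open>
  The reason is connectedness. Equal signs on all edges mean that \<open>d\<^sub>S - d\<^sub>T\<close> takes the same
  value at both ends of every edge, so it is constant on a connected graph. Both functions are
  nonnegative and vanish somewhere, namely on \<open>S\<close> and on \<open>T\<close>, so both have minimum \<open>0\<close> and the
  constant is \<open>0\<close> (\<open>set_dist_eqI\<close>). Since \<open>S\<close> is the zero set of \<open>d\<^sub>S\<close> and \<open>T\<close> that of \<open>d\<^sub>T\<close>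
  (\<open>set_dist_eq_0_iff\<close>), the two sets coincide.
\<close>

lemma (in pair_wf_digraph) graph_dist_eq_0_iff:
  assumes "u \<rightarrow>\<^sup>*\<^bsub>with_proj G\<^esub> v"
  shows "graph_dist G u v = 0 \<longleftrightarrow> u = v"
proof
  let ?P = "\<lambda>k. \<exists>p. awalk u p v \<and> length p = k"
  assume 0: "graph_dist G u v = 0"
  \<comment> \<open>Reachability is what lets the least element be attained: an empty set of lengths
    would leave the distance unspecified.\<close>
  have "\<exists>k. ?P k" using assms reachable_awalk by blast
  then have "?P (graph_dist G u v)" unfolding graph_dist_def by (rule LeastI_ex)
  then show "u = v" using 0 by (auto simp: awalk_Nil_iff)
next
  assume "u = v"
  moreover have "u \<in> pverts G" using assms by (auto dest: reachable_in_verts)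
  ultimately have "awalk u [] v" by (simp add: awalk_Nil_iff)
  then show "graph_dist G u v = 0" unfolding graph_dist_def by (intro Least_eq_0) auto
qed

lemma (in pair_wf_digraph) set_dist_eq_0_iff:
  assumes "strongly_connected (with_proj G)" "finite S" "S \<noteq> {}" "S \<subseteq> pverts G" "u \<in> pverts G"
  shows "set_dist G S u = 0 \<longleftrightarrow> u \<in> S"
proof -
  have dist: "graph_dist G u s = 0 \<longleftrightarrow> u = s" if "s \<in> S" for s
    using that assms by (intro graph_dist_eq_0_iff) (auto simp: strongly_connected_def)
  have "set_dist G S u = 0 \<longleftrightarrow> 0 \<in> graph_dist G u ` S"
    unfolding set_dist_def using assms(2,3) by (subst Min_eq_iff) auto
  also have "\<dots> \<longleftrightarrow> u \<in> S" using dist by force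
  finally show ?thesis .
qed

lemma (in pair_wf_digraph) set_dist_diff_constant:
  assumes "directionally_equivalent G S T" "u \<rightarrow>\<^sup>*\<^bsub>with_proj G\<^esub> v"
  shows "int (set_dist G S u) - int (set_dist G T u) = int (set_dist G S v) - int (set_dist G T v)"
  using assms(2)
proof (induction rule: reachable_induct)
  case (step x y)
  then have "edge_sign G S x y = edge_sign G T x y"
    using assms(1) by (auto simp: directionally_equivalent_def)
  then show ?case using step.IH by (simp add: edge_sign_def)
qed simp

text \<open>
  The constant value of \<open>d\<^sub>S - d\<^sub>T\<close> is at most \<open>0\<close>, as a point of \<open>S\<close> shows, and at least \<open>0\<close>, as
  a point of \<open>T\<close> shows.
\<close>

lemma (in pair_wf_digraph) set_dist_eqI:
  assumes conn: "strongly_connected (with_proj G)"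
    and S: "finite S" "S \<noteq> {}" "S \<subseteq> pverts G" and T: "finite T" "T \<noteq> {}" "T \<subseteq> pverts G"
    and equiv: "directionally_equivalent G S T" and u: "u \<in> pverts G"
  shows "set_dist G S u = set_dist G T u"
proof -
  obtain s t where st: "s \<in> S" "t \<in> T" using S T by blast
  then have verts: "s \<in> pverts G" "t \<in> pverts G" using S T by auto
  have diff: "int (set_dist G S u) - int (set_dist G T u) = int (set_dist G S v) - int (set_dist G T v)"
    if "v \<in> pverts G" for v
    using that u conn by (intro set_dist_diff_constant[OF equiv]) (auto simp: strongly_connected_def)
  have "set_dist G S s = 0" "set_dist G T t = 0"
    using set_dist_eq_0_iff[OF conn S] set_dist_eq_0_iff[OF conn T] st verts by auto
  then show ?thesis using diff[OF verts(1)] diff[OF verts(2)] by linarith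
qed

theorem (in pair_wf_digraph) directionally_equivalent_imp_eq:
  assumes "strongly_connected (with_proj G)"
    and "finite S" "S \<noteq> {}" "S \<subseteq> pverts G" and "finite T" "T \<noteq> {}" "T \<subseteq> pverts G"
    and "directionally_equivalent G S T"
  shows "S = T"
proof -
  have "u \<in> S \<longleftrightarrow> u \<in> T" if "u \<in> pverts G" for u
    using set_dist_eq_0_iff[of S u] set_dist_eq_0_iff[of T u] set_dist_eqI[of S T u] assms that
    by simp
  then show ?thesis using assms(4,7) by blast
qed

theorem corollary5p6:
  fixes n :: nat and S T :: "nat list set"
  assumes "n \<ge> 1"
    and "S \<subseteq> pverts (partition_graph n)" and "T \<subseteq> pverts (partition_graph n)"
    and "S \<noteq> {}" and "T \<noteq> {}" and "S \<noteq> T"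
  shows "\<not> directionally_equivalent (partition_graph n) S T \<and>
    (\<exists>(l, m)\<in>parcs (partition_graph n).
       edge_sign (partition_graph n) S l m \<noteq> edge_sign (partition_graph n) T l m)"
proof -
  interpret pair_graph "partition_graph n" by (rule pair_graph_partition_graph)
  have "strongly_connected (with_proj (partition_graph n))"
    using assms(1) by (intro symmetric_connected_imp_strongly_connected sym_arcs
      connected_partition_graph) simp
  moreover have "finite S" "finite T"
    using assms(2,3) finite_partitions by (auto simp: partition_graph_def intro: finite_subset)
  ultimately have "\<not> directionally_equivalent (partition_graph n) S T"
    using directionally_equivalent_imp_eq[of S T] assms by blast
  then show ?thesis by (auto simp: directionally_equivalent_def)
qed

end
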